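(* For every integer $n$ with $7 \leq n \leq 417$ and $n \notin \{22, 46, 78, 118, 166, 222, 286, 358\}$ (the excluded values are exactly $n = (2k+1)^2 - 3$ for $k = 2, 3, \dots, 9$), the maximum size of a spherical two-distance set in $\mathbb{R}^n$ is $$\frac{n(n+1)}{2}.$$
   Context: A set of unit vectors $S = \{x_1, x_2, \dots\} \subset \mathbb{R}^n$ is called a spherical two-distance set if there exist real numbers $a \neq b$ such that $\langle x_i, x_j \rangle \in \{a, b\}$ for all $i \neq j$. The numbers $a, b$ are allowed to depend on $S$; the maximum size is taken over all spherical two-distance sets in $\mathbb{R}^n$, for all choices of $a,b$. *)

theory Defs
  imports "HOL-Analysis.Analysis"
begin

definition spherical_two_distance_set :: "(real ^ 'n) set \<Rightarrow> bool" where
  "spherical_two_distance_set S \<longleftrightarrow>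
     (\<forall>x\<in>S. norm x = 1) \<and>
     (\<exists>a b :: real. a \<noteq> b \<and> (\<forall>x\<in>S. \<forall>y\<in>S. x \<noteq> y \<longrightarrow> x \<bullet> y \<in> {a, b}))"

(* Finiteness is part of the upper bound because card is 0 on infinite sets. *)
definition is_maximum_size :: "('a set \<Rightarrow> bool) \<Rightarrow> nat \<Rightarrow> bool" where
  "is_maximum_size P N \<longleftrightarrow>
     (\<exists>S. P S \<and> finite S \<and> card S = N) \<and>
     (\<forall>S. P S \<longrightarrow> finite S \<and> card S \<le> N)"

end

theory Submission
  imports
    Defs
    "HOL-Computational_Algebra.Field_as_Ring"
    "HOL-Computational_Algebra.Polynomial_Factorial"
    "Jordan_Normal_Form.Char_Poly"
begin

text \<open>
  For the lower bound, take the vertices of a regular simplex centred at the origin of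
  \<open>\<real>\<^sup>n\<close>. The sums of two distinct ones of these \<open>n + 1\<close> vectors, normalised, have inner
  products that only depend on whether the two pairs share a vertex; there are
  \<open>n (n + 1) / 2\<close> of them.

  For the upper bound, let \<open>b < a < 1\<close> be the two inner products of a finite set \<open>X\<close>. If
  \<open>a + b \<ge> 0\<close>, a dimension count in the space of symmetric matrices suffices
  (\<open>card_two_distance_le_of_sum_nonneg\<close>, Musin's bound). If \<open>a + b < 0\<close>, append a suitable
  constant coordinate to every vector and rescale: the two inner products become \<open>\<plusminus>\<alpha>\<close>, so that
  \<open>X\<close> turns into a set of equiangular lines in dimension \<open>m = n + 1\<close>.
  A set of more than \<open>n (n + 1) / 2\<close> such lines is large enough for \<open>1 / \<alpha>\<close> to be an odd
  integer \<open>q\<close>, because \<open>1 / \<alpha>\<close> comes from an eigenvalue of an integer matrix of size \<open>card X\<close>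
  whose multiplicity exceeds \<open>card X / 2\<close> (\<open>inverse_angle_odd_int\<close>).

  Three bounds for equiangular lines then exclude all cases but \<open>m = q\<^sup>2 - 2\<close>:
  \<^item> \<open>m \<le> q\<^sup>2 - 3\<close>: the relative bound \<open>card X \<le> m (q\<^sup>2 - 1) / (q\<^sup>2 - m)\<close> (\<open>relative_bound\<close>);
  \<^item> \<open>m = q\<^sup>2 - 1\<close>: the bound \<open>card X \<le> (q\<^sup>2 - 1) (q\<^sup>2 - 2) / 2\<close> (\<open>cubic_harmonic_bound\<close>);
  \<^item> \<open>m \<ge> q\<^sup>2\<close>: the bound \<open>card X \<le> m (q\<^sup>2 - 1) / 2\<close> (\<open>projection_bound\<close>).

  The last two bounds share one observation. Fix \<open>x \<in> X\<close> and project \<open>X - {x}\<close> to the orthogonal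
  complement of \<open>x\<close>. The Gram matrix of the projections has, up to sign, only two distinct entries
  off the diagonal, so that its entrywise cube is a linear combination of the Gram matrix of
  \<open>X - {x}\<close>, a matrix of rank one and the identity (\<open>sum_cubed_projected_gram\<close>). This cube is
  positive semidefinite; evaluating it at the reproducing kernel of the vectors gives the third
  bound. For the second one, it is evaluated at the vector \<open>(x \<bullet> y)\<^sub>y\<close>, and positivity is sharpened
  by the part of a cubic form that is orthogonal to the harmonic cubics (\<open>sum_inner_cubed_ge\<close>).

  The exceptional case is \<open>n = q\<^sup>2 - 3\<close> with \<open>q\<close> odd; for \<open>7 \<le> n \<le> 417\<close> these are the excluded
  dimensions.
\<close>

(* The symbol is reserved for the inner product of a Euclidean space. *)
no_notation Matrix.scalar_prod (infix "\<bullet>" 70)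

section \<open>The lower bound\<close>

text \<open>
  The \<open>n + 1\<close> vertices of a regular simplex in \<open>\<real>\<^sup>n\<close>, indexed by \<^typ>\<open>'n option\<close> because this type
  has exactly \<open>n + 1\<close> elements.
\<close>

lemma exists_simplex_vectors:
  "\<exists>p :: 'n::finite option \<Rightarrow> real ^ 'n. \<forall>i j. p i \<bullet> p j = (if i = j then 1 else 0) - 1 / (real CARD('n) + 1)"
proof -
  define n where "n = real CARD('n)"
  \<comment> \<open>All basis vectors are shifted by the same multiple \<open>\<kappa>\<close> of the all-ones vector \<open>e\<close>, where \<open>\<kappa>\<close>
    is a root of \<open>n \<kappa>\<^sup>2 + 2 \<kappa> + 1 / (n + 1) = 0\<close>; the last vertex is a multiple of \<open>e\<close>.\<close>
  define s where "s = 1 / sqrt (n + 1)"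
  define \<kappa> where "\<kappa> = (s - 1) / n"
  define e :: "real ^ 'n" where "e = (\<chi> i. 1)"
  define p :: "'n option \<Rightarrow> real ^ 'n" where 
    "p = (\<lambda>i. case i of None \<Rightarrow> - s *\<^sub>R e | Some i \<Rightarrow> axis i 1 + \<kappa> *\<^sub>R e)"
  have n: "n > 0" by (simp add: n_def)
  have s: "s * s = 1 / (n + 1)" using n by (simp add: s_def)
  have \<kappa>: "1 + \<kappa> * n = s" "\<kappa> * n = s - 1" using n by (simp_all add: \<kappa>_def)
  have ee: "e \<bullet> e = n" by (simp add: e_def n_def inner_vec_def)
  have ae: "axis i 1 \<bullet> e = 1" "e \<bullet> axis i 1 = 1" for i 
    by (simp_all add: e_def inner_axis inner_axis')
  have aa: "axis i (1::real) \<bullet> axis j 1 = (if i = j then 1 else 0)" for i j :: 'n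
    by (simp add: inner_axis_axis)
  have \<kappa>2: "2 * \<kappa> + \<kappa> * (\<kappa> * n) = - 1 / (n + 1)"
  proof -
    have "n * (2 * \<kappa> + \<kappa> * (\<kappa> * n)) = (\<kappa> * n) * (2 + \<kappa> * n)" by (simp add: algebra_simps)
    also have "\<dots> = s * s - 1" unfolding \<kappa>(2) by (simp add: algebra_simps)
    also have "\<dots> = n * (- 1 / (n + 1))" unfolding s using n by (simp add: field_simps)
    finally show ?thesis using n by (subst (asm) mult_cancel_left) simp
  qed
  have ns: "n * (s * s) = 1 - 1 / (n + 1)" unfolding s using n by (simp add: field_simps)
  have "p i \<bullet> p j = (if i = j then 1 else 0) - 1 / (n + 1)" for i j
  proof (cases i; cases j)
    assume "i = None" "j = None"
    thus ?thesis using ns by (simp add: p_def ee mult_ac)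
  next
    fix k assume "i = None" "j = Some k"
    hence "p i \<bullet> p j = - s * (1 + \<kappa> * n)" by (simp add: p_def inner_add_right ae ee algebra_simps)
    thus ?thesis using \<open>i = None\<close> \<open>j = Some k\<close> by (simp add: \<kappa>(1) s)
  next
    fix k assume "i = Some k" "j = None"
    hence "p i \<bullet> p j = - s * (1 + \<kappa> * n)" by (simp add: p_def inner_add_left ae ee algebra_simps)
    thus ?thesis using \<open>j = None\<close> \<open>i = Some k\<close> by (simp add: \<kappa>(1) s)
  next
    fix k l assume "i = Some k" "j = Some l"
    hence "p i \<bullet> p j = (if i = j then 1 else 0) + (2 * \<kappa> + \<kappa> * (\<kappa> * n))"
      by (simp add: p_def inner_add_left inner_add_right ae ee aa) (simp add: algebra_simps)
    thus ?thesis by (simp add: \<kappa>2)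
  qed
  thus ?thesis unfolding n_def by blast
qed

lemma exists_spherical_two_distance_set:
  assumes "CARD('n::finite) \<ge> 2"
  shows "\<exists>S :: (real ^ 'n) set. spherical_two_distance_set S \<and> finite S \<and> card S = CARD('n) * (CARD('n) + 1) div 2"
proof -
  obtain p :: "'n option \<Rightarrow> real ^ 'n" where
    p: "\<And>i j. p i \<bullet> p j = (if i = j then 1 else 0) - 1 / (real CARD('n) + 1)"
    using exists_simplex_vectors by blast
  define d where "d = 4 / (real CARD('n) + 1)"
  define r where "r = 1 / sqrt (2 - d)"
  define V where "V A = r *\<^sub>R sum p A" for A
  define P where "P = {A :: 'n option set. A \<subseteq> UNIV \<and> card A = 2}"
  have d: "d < 2" using assms by (simp add: d_def field_simps)
  hence r: "r * r = 1 / (2 - d)" by (simp add: r_def)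
  have V: "V A \<bullet> V B = (card (A \<inter> B) - d) / (2 - d)" if "A \<in> P" "B \<in> P" for A B
  proof -
    have "sum p A \<bullet> sum p B = (\<Sum>i\<in>A. \<Sum>j\<in>B. (if i = j then 1 else 0) - 1 / (real CARD('n) + 1))"
      by (simp add: inner_sum_left inner_sum_right p) (rule sum.swap)
    also have "\<dots> = (\<Sum>i\<in>A. if i \<in> B then 1 else 0) - d"
      using that by (simp add: sum_subtractf P_def d_def)
    also have "(\<Sum>i\<in>A. if i \<in> B then 1 else 0) = real (card (A \<inter> B))"
      by (simp flip: sum.inter_restrict)
    finally have "V A \<bullet> V B = (r * r) * (card (A \<inter> B) - d)" by (simp add: V_def)
    thus ?thesis by (simp add: r)
  qed
  have int: "card (A \<inter> B) < 2" if "A \<in> P" "B \<in> P" "A \<noteq> B" for A B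
  proof (rule ccontr)
    assume "\<not> card (A \<inter> B) < 2"
    hence "A \<inter> B = A" using that(1) card_seteq[of A "A \<inter> B"] by (simp add: P_def)
    hence "A = B" using that(1,2) card_subset_eq[of B A] by (auto simp: P_def)
    thus False using that(3) by blast
  qed
  have V1: "V A \<bullet> V A = 1" if "A \<in> P" for A using V[OF that that] that d by (simp add: P_def)
  have inj: "inj_on V P"
  proof (rule inj_onI, rule ccontr)
    fix A B assume AB: "A \<in> P" "B \<in> P" "V A = V B" "A \<noteq> B"
    hence "(card (A \<inter> B) - d) / (2 - d) = 1" using V[of A B] V1[of A] by simp
    thus False using d int[OF AB(1,2,4)] by simp
  qed
  have "spherical_two_distance_set (V ` P)"
    unfolding spherical_two_distance_set_def
  proof (intro conjI exI ballI impI)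
    fix x assume "x \<in> V ` P"
    thus "norm x = 1" using V1 by (auto simp: norm_eq_1)
  next
    show "(1 - d) / (2 - d) \<noteq> (0 - d) / (2 - d)"
      using d divide_cancel_right[of "1 - d" "2 - d" "0 - d"] by simp
  next
    fix x y assume "x \<in> V ` P" "y \<in> V ` P" "x \<noteq> y"
    then obtain A B where AB: "x = V A" "y = V B" "A \<in> P" "B \<in> P" "A \<noteq> B" by blast
    hence "card (A \<inter> B) = 0 \<or> card (A \<inter> B) = 1" using int[of A B] by linarith
    thus "x \<bullet> y \<in> {(1 - d) / (2 - d), (0 - d) / (2 - d)}" using V AB by auto
  qed
  moreover have "card (V ` P) = CARD('n) * (CARD('n) + 1) div 2"
    unfolding card_image[OF inj] unfolding P_def
    by (subst n_subsets) (simp_all add: choose_two mult.commute)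
  ultimately show ?thesis by (intro exI[of _ "V ` P"]) simp
qed

section \<open>Two inner products with nonnegative sum\<close>

lemma underdetermined_system_nontrivial:
  fixes g :: "'x \<Rightarrow> 'i \<Rightarrow> real"
  assumes "finite I" "finite S" "card I < card S"
  shows "\<exists>c. (\<exists>x\<in>S. c x \<noteq> 0) \<and> (\<forall>i\<in>I. (\<Sum>x\<in>S. c x * g x i) = 0)"
  using assms
proof (induction I arbitrary: S g rule: finite_induct)
  case empty
  then obtain x where "x \<in> S" by fastforce
  thus ?case by (intro exI[of _ "\<lambda>_. 1"]) auto
next
  case (insert i I)
  show ?case
  proof (cases "\<forall>x\<in>S. g x i = 0")
    case True
    obtain c where "\<exists>x\<in>S. c x \<noteq> 0" "\<forall>j\<in>I. (\<Sum>x\<in>S. c x * g x j) = 0"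
      using insert.IH[of S g] insert.prems insert.hyps by auto
    thus ?thesis using True by (intro exI[of _ c]) auto
  next
    case False
    then obtain z where z: "z \<in> S" "g z i \<noteq> 0" by blast
    define S' where "S' = S - {z}"
    have S: "S = insert z S'" "z \<notin> S'" "finite S'" using z insert.prems by (auto simp: S'_def)
    have "card I < card S'" using insert.prems insert.hyps S by simp
    then obtain c where c: "\<exists>x\<in>S'. c x \<noteq> 0"
      "\<And>j. j \<in> I \<Longrightarrow> (\<Sum>x\<in>S'. c x * (g x j - g x i / g z i * g z j)) = 0"
      using insert.IH[of S' "\<lambda>x j. g x j - g x i / g z i * g z j"] S(3) by auto
    define c' where "c' = c(z := - (\<Sum>x\<in>S'. c x * (g x i / g z i)))"
    have "(\<Sum>x\<in>S. c' x * g x j) = (\<Sum>x\<in>S'. c x * (g x j - g x i / g z i * g z j))" for j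
    proof -
      have "(\<Sum>x\<in>S. c' x * g x j) = (\<Sum>x\<in>S'. c' x * g x j) + c' z * g z j"
        using S by simp
      also have "(\<Sum>x\<in>S'. c' x * g x j) = (\<Sum>x\<in>S'. c x * g x j)"
        using S(2) by (intro sum.cong) (auto simp: c'_def)
      also have "c' z * g z j = - (\<Sum>x\<in>S'. c x * (g x i / g z i * g z j))"
        by (simp add: c'_def sum_distrib_right mult.assoc)
      finally show ?thesis by (simp add: sum_subtractf right_diff_distrib)
    qed
    moreover have "(\<Sum>x\<in>S'. c x * (g x i - g x i / g z i * g z i)) = 0" using z by simp
    moreover have "\<exists>x\<in>S. c' x \<noteq> 0" using c(1) S by (auto simp: c'_def)
    ultimately show ?thesis using c(2) by (intro exI[of _ c']) auto
  qed
qed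

text \<open>
  If \<open>X\<close> has more elements than the space of symmetric matrices has dimensions, there are
  coefficients \<open>c \<noteq> 0\<close> with \<open>\<Sum>x\<in>X. c x (x x\<^sup>T + a b I) = 0\<close>. The quadratic form of this matrix,
  evaluated at \<open>y \<in> X\<close>, says that \<open>c y (1 - a) (1 - b) = - (a + b) (u \<bullet> y)\<close> with
  \<open>u = (\<Sum>x\<in>X. c x x)\<close>, since \<open>(t - a) (t - b)\<close> vanishes at the inner products of \<open>y\<close> with the
  other elements of \<open>X\<close>. Multiplying by \<open>c y\<close> and summing yields
  \<open>(1 - a) (1 - b) (\<Sum>y\<in>X. (c y)\<^sup>2) = - (a + b) (u \<bullet> u) \<le> 0\<close>, a contradiction.
\<close>

lemma card_two_distance_le_of_sum_nonneg:
  fixes X :: "'a::euclidean_space set"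
  assumes X: "finite X" and unit: "\<And>x. x \<in> X \<Longrightarrow> x \<bullet> x = 1"
    and two: "\<And>x y. x \<in> X \<Longrightarrow> y \<in> X \<Longrightarrow> x \<noteq> y \<Longrightarrow> x \<bullet> y \<in> {a, b}"
    and ab: "a < 1" "b < 1" "a + b \<ge> 0"
  shows "2 * card X \<le> DIM('a) * (DIM('a) + 1)"
proof (rule ccontr)
  let ?m = "DIM('a)"
  assume neg: "\<not> 2 * card X \<le> ?m * (?m + 1)"
  \<comment> \<open>A numbering of the basis singles out the entries on and above the diagonal.\<close>
  obtain h :: "'a \<Rightarrow> nat" where h: "bij_betw h Basis {0..<?m}"
    using ex_bij_betw_finite_nat[of "Basis :: 'a set"] by auto
  define I :: "('a \<times> 'a) set" where "I = {(i, j). i \<in> Basis \<and> j \<in> Basis \<and> h i \<le> h j}"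
  have hinj: "inj_on h Basis" and hB: "\<And>i. i \<in> Basis \<Longrightarrow> h i < ?m"
    using h by (auto simp: bij_betw_def)
  have fI: "finite I" by (rule finite_subset[of _ "Basis \<times> Basis"]) (auto simp: I_def)
  have "card I \<le> card (SIGMA l:{..<?m}. {..l})"
  proof (rule card_inj_on_le[where f = "\<lambda>(i, j). (h j, h i)"])
    show "inj_on (\<lambda>(i, j). (h j, h i)) I" using hinj by (auto simp: inj_on_def I_def)
  qed (auto simp: I_def hB)
  also have "\<dots> = (\<Sum>l<?m. Suc l)" by simp
  finally have "card I \<le> (\<Sum>l<?m. Suc l)" .
  moreover have "2 * (\<Sum>l<k. Suc l) = k * (k + 1)" for k by (induction k) auto
  from this[of ?m] have "2 * (\<Sum>l<?m. Suc l) < 2 * card X" using neg by simp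
  ultimately have "card I < card X" by linarith
  then obtain c where c: "\<exists>x\<in>X. c x \<noteq> 0" and
    c0: "\<And>i j. (i, j) \<in> I \<Longrightarrow> (\<Sum>x\<in>X. c x * ((x \<bullet> i) * (x \<bullet> j) + (if i = j then a * b else 0))) = 0"
    using underdetermined_system_nontrivial[OF fI X, of "\<lambda>x (i, j). (x \<bullet> i) * (x \<bullet> j) + (if i = j then a * b else 0)"]
    by force
  have cB: "(\<Sum>x\<in>X. c x * ((x \<bullet> i) * (x \<bullet> j) + (if i = j then a * b else 0))) = 0"
    if "i \<in> Basis" "j \<in> Basis" for i j
  proof (cases "h i \<le> h j")
    case True
    thus ?thesis using c0 that by (auto simp: I_def)
  next
    case False
    hence "(j, i) \<in> I" using that by (auto simp: I_def)
    from c0[OF this] show ?thesis by (simp add: mult.commute eq_commute[of j i])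
  qed
  define u where "u = (\<Sum>x\<in>X. c x *\<^sub>R x)"
  have *: "c y * ((1 - a) * (1 - b)) + (a + b) * (u \<bullet> y) = 0" if y: "y \<in> X" for y
  proof -
    have "(x \<bullet> y)\<^sup>2 + a * b = (\<Sum>i\<in>Basis. \<Sum>j\<in>Basis. (y \<bullet> i) * (y \<bullet> j) * ((x \<bullet> i) * (x \<bullet> j) + (if i = j then a * b else 0)))" for x
    proof -
      have "(\<Sum>i\<in>Basis. \<Sum>j\<in>Basis. (y \<bullet> i) * (y \<bullet> j) * ((x \<bullet> i) * (x \<bullet> j) + (if i = j then a * b else 0)))
        = (\<Sum>i\<in>Basis. \<Sum>j\<in>Basis. ((x \<bullet> i) * (y \<bullet> i)) * ((x \<bullet> j) * (y \<bullet> j)) + (if i = j then (y \<bullet> i) * (y \<bullet> i) * (a * b) else 0))"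
        by (intro sum.cong refl) (simp add: algebra_simps)
      also have "\<dots> = (x \<bullet> y)\<^sup>2 + (y \<bullet> y) * (a * b)"
        unfolding euclidean_inner[of x y] euclidean_inner[of y y]
        by (simp add: sum.distrib power2_eq_square sum_product) (simp add: sum_distrib_right)
      finally show ?thesis using unit[OF y] by simp
    qed
    hence "(\<Sum>x\<in>X. c x * ((x \<bullet> y)\<^sup>2 + a * b)) =
      (\<Sum>x\<in>X. \<Sum>i\<in>Basis. \<Sum>j\<in>Basis. (y \<bullet> i) * (y \<bullet> j) * (c x * ((x \<bullet> i) * (x \<bullet> j) + (if i = j then a * b else 0))))"
      by (simp add: sum_distrib_left mult_ac)
    also have "\<dots> = (\<Sum>i\<in>Basis. \<Sum>j\<in>Basis. (y \<bullet> i) * (y \<bullet> j) * (\<Sum>x\<in>X. c x * ((x \<bullet> i) * (x \<bullet> j) + (if i = j then a * b else 0))))"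
      unfolding sum.swap[of _ Basis X] by (simp only: sum_distrib_left)
    also have "\<dots> = 0" using cB by simp
    finally have "0 = (\<Sum>x\<in>X. c x * ((x \<bullet> y)\<^sup>2 + a * b))" ..
    also have "\<dots> = (\<Sum>x\<in>X. (if x = y then c y * ((1 - a) * (1 - b)) else 0) + (a + b) * (c x * (x \<bullet> y)))"
    proof (intro sum.cong refl)
      fix x assume "x \<in> X"
      thus "c x * ((x \<bullet> y)\<^sup>2 + a * b) = (if x = y then c y * ((1 - a) * (1 - b)) else 0) + (a + b) * (c x * (x \<bullet> y))"
        using unit[OF y] two[OF _ y, of x] by (auto simp: algebra_simps power2_eq_square)
    qed
    also have "\<dots> = c y * ((1 - a) * (1 - b)) + (a + b) * (u \<bullet> y)"
      using X y by (simp add: sum.distrib u_def inner_sum_left sum_distrib_left)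
    finally show ?thesis ..
  qed
  have "0 = (\<Sum>y\<in>X. c y * (c y * ((1 - a) * (1 - b)) + (a + b) * (u \<bullet> y)))" using * by simp
  also have "\<dots> = ((1 - a) * (1 - b)) * (\<Sum>y\<in>X. (c y)\<^sup>2) + (a + b) * (u \<bullet> (\<Sum>y\<in>X. c y *\<^sub>R y))"
    by (simp add: distrib_left sum.distrib inner_sum_right sum_distrib_left power2_eq_square mult_ac)
  also have "u \<bullet> (\<Sum>y\<in>X. c y *\<^sub>R y) = u \<bullet> u" by (simp add: u_def)
  finally have "0 = ((1 - a) * (1 - b)) * (\<Sum>y\<in>X. (c y)\<^sup>2) + (a + b) * (u \<bullet> u)" .
  moreover have "(\<Sum>y\<in>X. (c y)\<^sup>2) > 0"
  proof -
    obtain x where "x \<in> X" "c x \<noteq> 0" using c by blast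
    thus ?thesis using X by (intro sum_pos2[of _ x]) auto
  qed
  hence "((1 - a) * (1 - b)) * (\<Sum>y\<in>X. (c y)\<^sup>2) > 0" using ab by simp
  moreover have "(a + b) * (u \<bullet> u) \<ge> 0" using ab by simp
  ultimately show False by linarith
qed

section \<open>Cubes of inner products\<close>

lemma sum_inner_cubed:
  fixes p :: "'x \<Rightarrow> 'a::euclidean_space" and v :: "'x \<Rightarrow> real"
  shows "(\<Sum>y\<in>Y. \<Sum>z\<in>Y. v y * v z * (p y \<bullet> p z) ^ 3) =
    (\<Sum>i\<in>Basis. \<Sum>j\<in>Basis. \<Sum>k\<in>Basis. (\<Sum>y\<in>Y. v y * (p y \<bullet> i) * (p y \<bullet> j) * (p y \<bullet> k))\<^sup>2)"
proof -
  have "(p y \<bullet> p z) ^ 3 = (\<Sum>i\<in>Basis. \<Sum>j\<in>Basis. \<Sum>k\<in>Basis.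
      ((p y \<bullet> i) * (p z \<bullet> i)) * ((p y \<bullet> j) * (p z \<bullet> j)) * ((p y \<bullet> k) * (p z \<bullet> k)))" for y z
  proof -
    have "(p y \<bullet> p z) ^ 3 = (p y \<bullet> p z) * ((p y \<bullet> p z) * (p y \<bullet> p z))"
      by (simp add: power3_eq_cube)
    also have "\<dots> = (\<Sum>i\<in>Basis. \<Sum>j\<in>Basis. \<Sum>k\<in>Basis.
      ((p y \<bullet> i) * (p z \<bullet> i)) * (((p y \<bullet> j) * (p z \<bullet> j)) * ((p y \<bullet> k) * (p z \<bullet> k))))"
      unfolding euclidean_inner[of "p y" "p z"] by (simp only: sum_product) (simp only: sum_distrib_left)
    finally show ?thesis by (simp add: mult.assoc)
  qed
  hence "(\<Sum>y\<in>Y. \<Sum>z\<in>Y. v y * v z * (p y \<bullet> p z) ^ 3) =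
    (\<Sum>y\<in>Y. \<Sum>z\<in>Y. \<Sum>i\<in>Basis. \<Sum>j\<in>Basis. \<Sum>k\<in>Basis.
      (v y * (p y \<bullet> i) * (p y \<bullet> j) * (p y \<bullet> k)) * (v z * (p z \<bullet> i) * (p z \<bullet> j) * (p z \<bullet> k)))"
    by (simp add: sum_distrib_left ac_simps)
  also have "\<dots> = (\<Sum>y\<in>Y. \<Sum>i\<in>Basis. \<Sum>j\<in>Basis. \<Sum>k\<in>Basis. \<Sum>z\<in>Y.
      (v y * (p y \<bullet> i) * (p y \<bullet> j) * (p y \<bullet> k)) * (v z * (p z \<bullet> i) * (p z \<bullet> j) * (p z \<bullet> k)))"
    by (simp only: sum.swap[of _ Basis Y])
  also have "\<dots> = (\<Sum>i\<in>Basis. \<Sum>j\<in>Basis. \<Sum>k\<in>Basis. \<Sum>y\<in>Y. \<Sum>z\<in>Y.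
      (v y * (p y \<bullet> i) * (p y \<bullet> j) * (p y \<bullet> k)) * (v z * (p z \<bullet> i) * (p z \<bullet> j) * (p z \<bullet> k)))"
    by (simp only: sum.swap[of _ Basis Y])
  also have "\<dots> = (\<Sum>i\<in>Basis. \<Sum>j\<in>Basis. \<Sum>k\<in>Basis. (\<Sum>y\<in>Y. v y * (p y \<bullet> i) * (p y \<bullet> j) * (p y \<bullet> k))\<^sup>2)"
    by (simp add: power2_eq_square sum_product)
  finally show ?thesis .
qed

text \<open>
  The cubic form \<open>z \<mapsto> \<Sum>y\<in>Y. v y (p y \<bullet> z)\<^sup>3\<close> has the coefficient tensor \<open>T\<close>, and the left-hand side
  is the square of the norm of the orthogonal projection of \<open>T\<close> to the line of the tensors \<open>c U\<close> of
  the forms \<open>z \<mapsto> 3 c (u \<bullet> z) (z \<bullet> z)\<close>. In other words, the cubic Gegenbauer polynomial is positive definite.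
\<close>

lemma sum_inner_cubed_ge:
  fixes p :: "'x \<Rightarrow> 'a::euclidean_space" and v :: "'x \<Rightarrow> real"
  assumes norm: "\<And>y. y \<in> Y \<Longrightarrow> p y \<bullet> p y = \<rho>"
  defines "u \<equiv> (\<Sum>y\<in>Y. v y *\<^sub>R p y)"
  shows "3 * \<rho>\<^sup>2 / (DIM('a) + 2) * (u \<bullet> u) \<le> (\<Sum>y\<in>Y. \<Sum>z\<in>Y. v y * v z * (p y \<bullet> p z) ^ 3)"
proof -
  define T where "T i j k = (\<Sum>y\<in>Y. v y * (p y \<bullet> i) * (p y \<bullet> j) * (p y \<bullet> k))" for i j k
  define c where "c = \<rho> / (DIM('a) + 2)"
  define d :: "'a \<Rightarrow> 'a \<Rightarrow> real" where "d i j = (if i = j then 1 else 0)" for i j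
  let ?S = "\<lambda>f. \<Sum>i\<in>Basis. \<Sum>j\<in>Basis. \<Sum>k\<in>Basis. f i j k :: real"
  have uu: "u \<bullet> u = (\<Sum>i\<in>Basis. (u \<bullet> i)\<^sup>2)"
    unfolding euclidean_inner[of u u] by (simp add: power2_eq_square)
  \<comment> \<open>The contraction of \<open>T\<close> is \<open>\<rho> u\<close>, because all \<open>p y\<close> have the same norm.\<close>
  have tr: "(\<Sum>j\<in>Basis. T i j j) = \<rho> * (u \<bullet> i)" for i
  proof -
    have "(\<Sum>j\<in>Basis. T i j j) = (\<Sum>y\<in>Y. \<Sum>j\<in>Basis. v y * (p y \<bullet> i) * ((p y \<bullet> j) * (p y \<bullet> j)))"
      unfolding T_def by (subst sum.swap) (simp add: mult.assoc)
    also have "\<dots> = (\<Sum>y\<in>Y. v y * (p y \<bullet> i) * \<rho>)"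
      by (intro sum.cong refl) (simp add: norm flip: sum_distrib_left euclidean_inner)
    finally show ?thesis by (simp add: u_def inner_sum_left sum_distrib_left mult_ac)
  qed
  have Tsym: "T i j k = T j i k" "T i j k = T i k j" for i j k
    unfolding T_def by (simp_all add: mult_ac)
  have delta: "(\<Sum>j\<in>Basis. d i j * f j) = f i" "(\<Sum>j\<in>Basis. d j i * f j) = f i" 
    if "i \<in> Basis" for i and f :: "'a \<Rightarrow> real"
    using that by (simp_all add: d_def if_distrib[of "\<lambda>x. x * _"] sum.delta cong: if_cong)
  have T1: "?S (\<lambda>i j k. T i j k * ((u \<bullet> i) * d j k)) = \<rho> * (u \<bullet> u)"
  proof -
    have "?S (\<lambda>i j k. T i j k * ((u \<bullet> i) * d j k)) = 
        (\<Sum>i\<in>Basis. \<Sum>j\<in>Basis. (\<Sum>k\<in>Basis. d j k * ((u \<bullet> i) * T i j k)))"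
      by (simp add: mult_ac)
    also have "\<dots> = (\<Sum>i\<in>Basis. (u \<bullet> i) * (\<Sum>j\<in>Basis. T i j j))"
      by (simp add: delta sum_distrib_left)
    finally show ?thesis by (simp add: tr uu power2_eq_square sum_distrib_left mult_ac)
  qed
  have T2: "?S (\<lambda>i j k. T i j k * ((u \<bullet> j) * d i k)) = \<rho> * (u \<bullet> u)"
    unfolding T1[symmetric] by (subst sum.swap) (subst Tsym(1), rule refl)
  have swap23: "?S f = ?S (\<lambda>i j k. f i k j)" for f :: "'a \<Rightarrow> 'a \<Rightarrow> 'a \<Rightarrow> real"
    by (intro sum.cong refl sum.swap)
  have T3: "?S (\<lambda>i j k. T i j k * ((u \<bullet> k) * d i j)) = \<rho> * (u \<bullet> u)"
    unfolding T2[symmetric] by (subst swap23) (subst Tsym(2), rule refl)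
  define U where "U i j k = (u \<bullet> i) * d j k + (u \<bullet> j) * d i k + (u \<bullet> k) * d i j" for i j k
  have TU: "?S (\<lambda>i j k. T i j k * U i j k) = 3 * \<rho> * (u \<bullet> u)"
    unfolding U_def using T1 T2 T3 by (simp add: distrib_left sum.distrib)
  have U1: "?S (\<lambda>i j k. (u \<bullet> i) * d j k * ((u \<bullet> i) * d j k)) = DIM('a) * (u \<bullet> u)"
  proof -
    have "?S (\<lambda>i j k. (u \<bullet> i) * d j k * ((u \<bullet> i) * d j k)) =
       (\<Sum>i\<in>Basis. \<Sum>j\<in>Basis. \<Sum>k\<in>Basis. d j k * (u \<bullet> i)\<^sup>2)"
      by (intro sum.cong refl) (simp add: d_def power2_eq_square)
    thus ?thesis by (simp add: delta uu sum_distrib_left)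
  qed
  have U12: "?S (\<lambda>i j k. (u \<bullet> i) * d j k * ((u \<bullet> j) * d i k)) = u \<bullet> u"
  proof -
    have "?S (\<lambda>i j k. (u \<bullet> i) * d j k * ((u \<bullet> j) * d i k)) =
       (\<Sum>i\<in>Basis. \<Sum>j\<in>Basis. \<Sum>k\<in>Basis. d j k * ((u \<bullet> i) * (u \<bullet> j) * d i k))"
      by (simp add: mult_ac)
    also have "\<dots> = (\<Sum>i\<in>Basis. \<Sum>j\<in>Basis. d i j * ((u \<bullet> i) * (u \<bullet> j)))"
      by (intro sum.cong refl) (simp only: delta(1), simp add: mult_ac)
    finally show ?thesis by (simp add: delta uu power2_eq_square)
  qed
  have U13: "?S (\<lambda>i j k. (u \<bullet> i) * d j k * ((u \<bullet> k) * d i j)) = u \<bullet> u"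
  proof -
    have "?S (\<lambda>i j k. (u \<bullet> i) * d j k * ((u \<bullet> k) * d i j)) =
       (\<Sum>i\<in>Basis. \<Sum>j\<in>Basis. \<Sum>k\<in>Basis. d j k * ((u \<bullet> i) * (u \<bullet> k) * d i j))"
      by (simp add: mult_ac)
    also have "\<dots> = (\<Sum>i\<in>Basis. \<Sum>j\<in>Basis. d i j * ((u \<bullet> i) * (u \<bullet> j)))"
      by (intro sum.cong refl) (simp only: delta(1), simp add: mult_ac)
    finally show ?thesis by (simp add: delta uu power2_eq_square)
  qed
  have UT: "?S (\<lambda>i j k. U i j k * U i j k) = 3 * ?S (\<lambda>i j k. (u \<bullet> i) * d j k * U i j k)"
  proof -
    have Us: "U i j k = U j i k" "U i j k = U i k j" for i j k
      unfolding U_def d_def by auto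
    have 1: "?S (\<lambda>i j k. (u \<bullet> j) * d i k * U i j k) = ?S (\<lambda>i j k. (u \<bullet> i) * d j k * U i j k)"
      by (subst sum.swap) (subst Us(1), rule refl)
    have 2: "?S (\<lambda>i j k. (u \<bullet> k) * d i j * U i j k) = ?S (\<lambda>i j k. (u \<bullet> j) * d i k * U i j k)"
      by (subst swap23) (subst Us(2), rule refl)
    have "?S (\<lambda>i j k. U i j k * U i j k) = ?S (\<lambda>i j k. (u \<bullet> i) * d j k * U i j k) +
      ?S (\<lambda>i j k. (u \<bullet> j) * d i k * U i j k) + ?S (\<lambda>i j k. (u \<bullet> k) * d i j * U i j k)"
      by (subst (1) U_def) (simp only: distrib_right sum.distrib)
    thus ?thesis using 1 2 by simp
  qed
  also have "?S (\<lambda>i j k. (u \<bullet> i) * d j k * U i j k) = (DIM('a) + 2) * (u \<bullet> u)"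
    unfolding U_def using U1 U12 U13 by (simp add: distrib_left distrib_right sum.distrib)
  finally have UU: "?S (\<lambda>i j k. U i j k * U i j k) = 3 * ((DIM('a) + 2) * (u \<bullet> u))" .
  have "0 \<le> ?S (\<lambda>i j k. (T i j k - c * U i j k)\<^sup>2)"
    by (intro sum_nonneg) simp
  also have "\<dots> = ?S (\<lambda>i j k. (T i j k)\<^sup>2 - 2 * c * (T i j k * U i j k) + c\<^sup>2 * (U i j k * U i j k))"
    by (simp add: power2_eq_square algebra_simps)
  also have "\<dots> = ?S (\<lambda>i j k. (T i j k)\<^sup>2) - 2 * c * ?S (\<lambda>i j k. T i j k * U i j k)
      + c\<^sup>2 * ?S (\<lambda>i j k. U i j k * U i j k)"
    by (simp add: sum.distrib sum_subtractf sum_distrib_left)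
  also have "\<dots> = ?S (\<lambda>i j k. (T i j k)\<^sup>2) - 3 * \<rho>\<^sup>2 / (DIM('a) + 2) * (u \<bullet> u)"
  proof -
    have c: "c * (DIM('a) + 2) = \<rho>" by (simp add: c_def)
    have "2 * c * (3 * \<rho> * (u \<bullet> u)) = 6 * (\<rho> * c * (u \<bullet> u))" by simp
    moreover have "c\<^sup>2 * (3 * ((DIM('a) + 2) * (u \<bullet> u))) = 3 * (\<rho> * c * (u \<bullet> u))"
      unfolding c[symmetric] by (simp add: power2_eq_square)
    moreover have "3 * \<rho>\<^sup>2 / (DIM('a) + 2) * (u \<bullet> u) = 3 * (\<rho> * c * (u \<bullet> u))"
      by (simp add: c_def power2_eq_square)
    ultimately show ?thesis unfolding TU UU by linarith
  qed
  finally show ?thesis unfolding sum_inner_cubed T_def by simp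
qed

text \<open>
  The matrix \<open>v\<close> is the orthogonal projection of \<open>\<real>\<^sup>X\<close> onto the row space of the matrix with columns
  \<open>x \<in> X\<close>: \<open>v x y = L x \<bullet> y\<close>, where \<open>L\<close> inverts the frame operator \<open>z \<mapsto> \<Sum>y\<in>X. (z \<bullet> y) y\<close> on the
  span of \<open>X\<close>. Its trace is the dimension of that span.
\<close>

lemma reproducing_kernel:
  fixes X :: "'a::euclidean_space set"
  assumes X: "finite X"
  obtains v where "\<And>x. x \<in> X \<Longrightarrow> (\<Sum>y\<in>X. v x y *\<^sub>R y) = x"
    "\<And>x. x \<in> X \<Longrightarrow> (\<Sum>y\<in>X. (v x y)\<^sup>2) = v x x" "(\<Sum>x\<in>X. v x x) \<le> DIM('a)"
proof -
  define W where "W = {z. \<forall>x\<in>X. x \<bullet> z = 0}"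
  have W: "subspace W" unfolding W_def subspace_def by (auto simp: inner_right_distrib)
  obtain B where B: "B \<subseteq> W" "independent B" "W \<subseteq> span B"
    using basis_exists[of W] by metis
  have fB: "finite B" using B(2) independent_imp_finite by blast
  \<comment> \<open>A basis \<open>B\<close> of the orthogonal complement of \<open>X\<close> makes the frame operator invertible on the whole
    space and does not change its values on the span of \<open>X\<close>.\<close>
  define F where "F z = (\<Sum>y\<in>X. (z \<bullet> y) *\<^sub>R y) + (\<Sum>b\<in>B. (z \<bullet> b) *\<^sub>R b)" for z
  have FF: "z \<bullet> F z = (\<Sum>y\<in>X. (z \<bullet> y)\<^sup>2) + (\<Sum>b\<in>B. (z \<bullet> b)\<^sup>2)" for z
    by (simp add: F_def inner_right_distrib inner_sum_right power2_eq_square)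
  have lin: "linear F"
    by (rule linearI) (simp_all add: F_def inner_left_distrib scaleR_left_distrib sum.distrib scaleR_right.sum scaleR_right_distrib)
  have "inj F"
  proof (subst linear_injective_0[OF lin], intro allI impI)
    fix z assume "F z = 0"
    hence "(\<Sum>y\<in>X. (z \<bullet> y)\<^sup>2) + (\<Sum>b\<in>B. (z \<bullet> b)\<^sup>2) = 0" using FF[of z] by simp
    hence "(\<Sum>y\<in>X. (z \<bullet> y)\<^sup>2) = 0" "(\<Sum>b\<in>B. (z \<bullet> b)\<^sup>2) = 0"
      by (smt (verit) sum_nonneg zero_le_power2)+
    hence 0: "\<forall>y\<in>X. z \<bullet> y = 0" "\<forall>b\<in>B. z \<bullet> b = 0"
      using X fB by (simp_all add: sum_nonneg_eq_0_iff)
    hence "z \<in> span B" using B(3) by (auto simp: W_def inner_commute)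
    hence "Linear_Algebra.orthogonal z z"
      by (rule orthogonal_to_span) (use 0 in \<open>auto simp: Linear_Algebra.orthogonal_def\<close>)
    thus "z = 0" by (simp add: Linear_Algebra.orthogonal_def)
  qed
  then obtain L where L: "linear L" "\<And>x. L (F x) = x" "\<And>x. F (L x) = x"
    using linear_injective_isomorphism[OF lin] by blast
  have pos: "L z \<bullet> z \<ge> 0" for z
    using FF[of "L z"] L(3)[of z] by (simp add: sum_nonneg)
  have rep: "(\<Sum>y\<in>X. (L x \<bullet> y) *\<^sub>R y) = x" if "x \<in> X" for x
  proof -
    define r where "r = (\<Sum>b\<in>B. (L x \<bullet> b) *\<^sub>R b)"
    define q where "q = (\<Sum>y\<in>X. (L x \<bullet> y) *\<^sub>R y)"
    have x: "x = q + r" using L(3)[of x] by (simp add: F_def r_def q_def)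
    have "r \<in> W" unfolding r_def using B(1) by (intro subspace_sum[OF W] subspace_scale[OF W]) auto
    hence 0: "r \<bullet> y = 0" if "y \<in> X" for y using that inner_commute[of r y] by (simp add: W_def)
    have "r \<bullet> q = 0" using 0 by (simp add: q_def inner_sum_right)
    moreover have "r \<bullet> x = r \<bullet> q + r \<bullet> r" by (subst x) (simp add: inner_right_distrib)
    ultimately have "r = 0" using 0[OF that] by simp
    thus ?thesis using x by (simp add: q_def)
  qed
  \<comment> \<open>The trace of \<open>L \<circ> F\<close> is computed in two ways; the elements of \<open>B\<close> contribute nonnegatively.\<close>
  have "real (DIM('a)) = (\<Sum>i\<in>(Basis::'a set). L (F i) \<bullet> i)" by (simp add: L(2))
  also have "\<dots> = (\<Sum>i\<in>Basis. (\<Sum>y\<in>X. (L y \<bullet> i) * (y \<bullet> i)) + (\<Sum>b\<in>B. (L b \<bullet> i) * (b \<bullet> i)))"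
    by (simp add: F_def linear_add[OF L(1)] linear_sum[OF L(1)] linear_scale[OF L(1)] inner_add_left
        inner_sum_left) (simp add: inner_commute mult.commute)
  also have "\<dots> = (\<Sum>y\<in>X. L y \<bullet> y) + (\<Sum>b\<in>B. L b \<bullet> b)"
    unfolding sum.distrib sum.swap[of _ X Basis] sum.swap[of _ B Basis] by (simp flip: euclidean_inner)
  finally have "(\<Sum>x\<in>X. L x \<bullet> x) \<le> DIM('a)" using pos by (simp add: sum_nonneg)
  moreover have "(\<Sum>y\<in>X. (L x \<bullet> y)\<^sup>2) = L x \<bullet> x" if "x \<in> X" for x
  proof -
    have "L x \<bullet> x = L x \<bullet> (\<Sum>y\<in>X. (L x \<bullet> y) *\<^sub>R y)" using rep[OF that] by simp
    thus ?thesis by (simp add: inner_sum_right power2_eq_square)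
  qed
  ultimately show ?thesis using rep that[of "\<lambda>x y. L x \<bullet> y"] by blast
qed


text \<open>
  For \<open>t = y \<bullet> z\<close> and \<open>s = (x \<bullet> y) (x \<bullet> z)\<close> with \<open>y \<noteq> z\<close>, the relations \<open>t\<^sup>2 = \<beta>\<close> and \<open>s\<^sup>2 = \<beta>\<^sup>2\<close> make
  \<open>(t - s)\<^sup>3\<close> linear in \<open>t\<close> and \<open>s\<close>; the diagonal contributes the multiple of the identity.
\<close>

lemma sum_cubed_projected_gram:
  fixes x :: "'a::euclidean_space" and v :: "'a \<Rightarrow> real"
  assumes Y: "finite Y" and unit: "\<And>y. y \<in> Y \<Longrightarrow> y \<bullet> y = 1"
    and angle: "\<And>y z. y \<in> Y \<Longrightarrow> z \<in> Y \<Longrightarrow> y \<noteq> z \<Longrightarrow> (y \<bullet> z)\<^sup>2 = \<beta>"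
    and x: "\<And>y. y \<in> Y \<Longrightarrow> (x \<bullet> y)\<^sup>2 = \<beta>" "x \<bullet> x = 1"
  defines "p \<equiv> \<lambda>y. y - (x \<bullet> y) *\<^sub>R x" and "q \<equiv> (\<Sum>y\<in>Y. v y *\<^sub>R y)"
  shows "(\<Sum>y\<in>Y. \<Sum>z\<in>Y. v y * v z * (p y \<bullet> p z) ^ 3) =
    \<beta> * (1 + 3 * \<beta>) * (q \<bullet> q) - \<beta> * (3 + \<beta>) * (x \<bullet> q)\<^sup>2 + (1 - \<beta>) * (1 - 3 * \<beta>) * (\<Sum>y\<in>Y. (v y)\<^sup>2)"
proof -
  let ?\<kappa> = "(1 - \<beta>) * (1 - 3 * \<beta>)"
  have cube: "(p y \<bullet> p z) ^ 3 = \<beta> * (1 + 3 * \<beta>) * (y \<bullet> z) - \<beta> * (3 + \<beta>) * ((x \<bullet> y) * (x \<bullet> z)) + (if y = z then ?\<kappa> else 0)"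
    if "y \<in> Y" "z \<in> Y" for y z
  proof -
    define t s where "t = y \<bullet> z" and "s = (x \<bullet> y) * (x \<bullet> z)"
    have p: "p y \<bullet> p z = t - s"
      by (simp add: p_def inner_diff_left inner_diff_right x(2) t_def s_def inner_commute)
    have ss: "s * s = \<beta> * \<beta>"
      using x(1)[OF that(1)] x(1)[OF that(2)] by (simp add: s_def power2_eq_square mult_ac)
    have "(t - s) ^ 3 = \<beta> * (1 + 3 * \<beta>) * t - \<beta> * (3 + \<beta>) * s + (if y = z then ?\<kappa> else 0)"
    proof (cases "y = z")
      case True
      have "t = 1" "s = \<beta>" using True x(1) that unit by (simp_all add: t_def s_def power2_eq_square)
      thus ?thesis using True by (simp add: algebra_simps power3_eq_cube)
    next
      case False
      hence tt: "t * t = \<beta>" using angle[OF that] by (simp add: t_def power2_eq_square)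
      have "(t - s) ^ 3 = (t * t) * t - 3 * (t * t) * s + 3 * t * (s * s) - (s * s) * s"
        by (simp add: power3_eq_cube algebra_simps)
      also have "\<dots> = \<beta> * (1 + 3 * \<beta>) * t - \<beta> * (3 + \<beta>) * s"
        unfolding tt ss by (simp add: algebra_simps)
      finally show ?thesis using False by simp
    qed
    thus ?thesis unfolding p unfolding t_def s_def .
  qed
  have "(\<Sum>y\<in>Y. \<Sum>z\<in>Y. v y * v z * (p y \<bullet> p z) ^ 3) =
    (\<Sum>y\<in>Y. \<Sum>z\<in>Y. \<beta> * (1 + 3 * \<beta>) * (v y * v z * (y \<bullet> z)) - \<beta> * (3 + \<beta>) * ((v y * (x \<bullet> y)) * (v z * (x \<bullet> z)))
      + (if y = z then ?\<kappa> * (v y)\<^sup>2 else 0))"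
    by (intro sum.cong refl, subst cube) (auto simp: algebra_simps power2_eq_square)
  also have "\<dots> = \<beta> * (1 + 3 * \<beta>) * (\<Sum>y\<in>Y. \<Sum>z\<in>Y. v y * v z * (y \<bullet> z))
     - \<beta> * (3 + \<beta>) * (\<Sum>y\<in>Y. \<Sum>z\<in>Y. (v y * (x \<bullet> y)) * (v z * (x \<bullet> z))) + ?\<kappa> * (\<Sum>y\<in>Y. (v y)\<^sup>2)"
    using Y by (simp add: sum.distrib sum_subtractf sum_distrib_left)
  also have "(\<Sum>y\<in>Y. \<Sum>z\<in>Y. (v y * (x \<bullet> y)) * (v z * (x \<bullet> z))) = (x \<bullet> q)\<^sup>2"
    by (simp add: q_def inner_sum_right power2_eq_square sum_product)
  also have "(\<Sum>y\<in>Y. \<Sum>z\<in>Y. v y * v z * (y \<bullet> z)) = q \<bullet> q"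
    by (simp add: q_def inner_sum_right inner_sum_left sum_distrib_left mult_ac inner_commute)
  finally show ?thesis .
qed

section \<open>Bounds for equiangular lines\<close>

text \<open>
  A finite set of unit vectors that span equiangular lines, one vector for each line. The parameter
  \<open>\<beta>\<close> is the square of the cosine \<open>\<alpha>\<close> of the common angle, so that the sign of an inner product
  is left open.
\<close>

locale equiangular_set =
  fixes X :: "'a::euclidean_space set" and \<beta> :: real
  assumes finite: "finite X" and unit: "x \<in> X \<Longrightarrow> x \<bullet> x = 1"
    and angle: "x \<in> X \<Longrightarrow> y \<in> X \<Longrightarrow> x \<noteq> y \<Longrightarrow> (x \<bullet> y)\<^sup>2 = \<beta>"
    and pos: "0 < \<beta>" and less_1: "\<beta> < 1"
begin

text \<open>
  Each diagonal entry of the reproducing kernel is at least \<open>1 / (1 + (card X - 1) \<beta>)\<close> by the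
  Cauchy-Schwarz inequality, and the trace is at most the dimension.
\<close>

lemma relative_bound: "card X * (1 - DIM('a) * \<beta>) \<le> DIM('a) * (1 - \<beta>)"
proof -
  obtain v where v: "\<And>x. x \<in> X \<Longrightarrow> (\<Sum>y\<in>X. v x y *\<^sub>R y) = x"
    "\<And>x. x \<in> X \<Longrightarrow> (\<Sum>y\<in>X. (v x y)\<^sup>2) = v x x" "(\<Sum>x\<in>X. v x x) \<le> DIM('a)"
    by (rule reproducing_kernel[OF finite]) (rule that)
  define c where "c = 1 + (card X - 1) * \<beta>"
  have "1 \<le> c * v x x" if x: "x \<in> X" for x
  proof -
    have "x \<bullet> x = x \<bullet> (\<Sum>y\<in>X. v x y *\<^sub>R y)" using v(1)[OF x] by simp
    hence "1 = (\<Sum>y\<in>X. v x y * (x \<bullet> y))" using unit[OF x] by (simp add: inner_sum_right)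
    hence "1 = (\<Sum>y\<in>X. v x y * (x \<bullet> y))\<^sup>2" by simp
    also have "\<dots> \<le> (\<Sum>y\<in>X. (v x y)\<^sup>2) * (\<Sum>y\<in>X. (x \<bullet> y)\<^sup>2)" by (rule Cauchy_Schwarz_ineq_sum)
    also have "(\<Sum>y\<in>X. (x \<bullet> y)\<^sup>2) = 1 + (\<Sum>y\<in>X - {x}. (x \<bullet> y)\<^sup>2)"
      using finite x unit by (simp add: sum.remove)
    also have "(\<Sum>y\<in>X - {x}. (x \<bullet> y)\<^sup>2) = (\<Sum>y\<in>X - {x}. \<beta>)"
      using angle x by (intro sum.cong) auto
    finally show ?thesis using x finite v(2) by (simp add: c_def mult.commute)
  qed
  hence "(\<Sum>x\<in>X. 1) \<le> (\<Sum>x\<in>X. c * v x x)" by (intro sum_mono) auto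
  also have "\<dots> = c * (\<Sum>x\<in>X. v x x)" by (simp add: sum_distrib_left)
  also have "\<dots> \<le> c * DIM('a)" 
    using v(3) pos by (intro mult_left_mono) (auto simp: c_def)
  finally have *: "card X \<le> (1 + (card X - 1) * \<beta>) * DIM('a)" by (simp add: c_def)
  show ?thesis
  proof (cases "card X = 0")
    case False
    hence "real (card X - 1) = real (card X) - 1" by simp
    thus ?thesis using * by (simp add: algebra_simps)
  qed (use less_1 in auto)
qed

text \<open>
  The entrywise cube of the Gram matrix of the projections to the complement of \<open>x\<close>, evaluated at row
  \<open>x\<close> of the reproducing kernel, shows that the diagonal entry \<open>w\<close> of that row satisfies
  \<open>w \<ge> 2 \<beta> / (1 - \<beta>)\<close>. The bound follows since the trace is at most the dimension.
\<close>

lemma projection_bound: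
  assumes "3 * \<beta> \<le> 1"
  shows "card X * (2 * \<beta>) \<le> DIM('a) * (1 - \<beta>)"
proof -
  obtain v where v: "\<And>x. x \<in> X \<Longrightarrow> (\<Sum>y\<in>X. v x y *\<^sub>R y) = x"
    "\<And>x. x \<in> X \<Longrightarrow> (\<Sum>y\<in>X. (v x y)\<^sup>2) = v x x" "(\<Sum>x\<in>X. v x x) \<le> DIM('a)"
    by (rule reproducing_kernel[OF finite]) (rule that)
  have "2 * \<beta> \<le> v x x * (1 - \<beta>)" if x: "x \<in> X" for x
  proof -
    define Y where "Y = X - {x}"
    define w where "w = v x x"
    define q where "q = (\<Sum>y\<in>Y. v x y *\<^sub>R y)"
    have q: "q = (1 - w) *\<^sub>R x"
      using v(1)[OF x] finite x by (simp add: sum.remove q_def Y_def w_def algebra_simps)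
    have ww: "(\<Sum>y\<in>Y. (v x y)\<^sup>2) = w * (1 - w)"
      using v(2)[OF x] finite x by (simp add: sum.remove Y_def w_def algebra_simps power2_eq_square)
    have "0 \<le> w * (1 - w)" unfolding ww[symmetric] by (intro sum_nonneg) simp
    hence w1: "w \<le> 1" by (smt (verit) mult_nonneg_nonpos mult_pos_neg)
    have "0 \<le> (\<Sum>y\<in>Y. \<Sum>z\<in>Y. v x y * v x z * ((y - (x \<bullet> y) *\<^sub>R x) \<bullet> (z - (x \<bullet> z) *\<^sub>R x)) ^ 3)"
      unfolding sum_inner_cubed by (intro sum_nonneg) simp
    also have "\<dots> = \<beta> * (1 + 3 * \<beta>) * (q \<bullet> q) - \<beta> * (3 + \<beta>) * (x \<bullet> q)\<^sup>2 
        + (1 - \<beta>) * (1 - 3 * \<beta>) * (\<Sum>y\<in>Y. (v x y)\<^sup>2)"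
      unfolding q_def using x finite unit angle 
      by (intro sum_cubed_projected_gram) (auto simp: Y_def)
    also have "\<dots> = (1 - \<beta>) * (1 - w) * (w * (1 - \<beta>) - 2 * \<beta>)"
      unfolding q ww using unit[OF x] by (simp add: algebra_simps power2_eq_square)
    finally have *: "0 \<le> (1 - \<beta>) * (1 - w) * (w * (1 - \<beta>) - 2 * \<beta>)" .
    show ?thesis
    proof (cases "w = 1")
      case True
      thus ?thesis using assms by (simp add: w_def)
    next
      case False
      hence "0 < (1 - \<beta>) * (1 - w)" using w1 less_1 by simp
      thus ?thesis using * by (simp add: zero_le_mult_iff w_def)
    qed
  qed
  hence "(\<Sum>x\<in>X. 2 * \<beta>) \<le> (\<Sum>x\<in>X. v x x * (1 - \<beta>))" by (intro sum_mono) auto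
  also have "\<dots> = (\<Sum>x\<in>X. v x x) * (1 - \<beta>)" by (simp add: sum_distrib_right)
  also have "\<dots> \<le> DIM('a) * (1 - \<beta>)" using v(3) less_1 by (intro mult_right_mono) auto
  finally show ?thesis by simp
qed

text \<open>
  The hypothesis on the dimension makes the coefficient of \<open>u \<bullet> u\<close> in the evaluated cube at most
  the one in \<open>sum_inner_cubed_ge\<close>, so that these two terms can be dropped.
\<close>

lemma cubic_harmonic_bound:
  assumes dim: "(DIM('a) + 2) * (\<beta> * (1 + 3 * \<beta>)) \<le> 3 * (1 - \<beta>)\<^sup>2" and "3 * \<beta> \<le> 1"
  shows "(real (card X) - 1) * (2 * \<beta>\<^sup>2) \<le> 1 - 3 * \<beta>"
proof (cases "card X \<le> 1")
  case True
  hence "(real (card X) - 1) * (2 * \<beta>\<^sup>2) \<le> 0" by (intro mult_nonpos_nonneg) auto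
  thus ?thesis using assms by linarith
next
  case False
  then obtain x where x: "x \<in> X" by fastforce
  define Y where "Y = X - {x}"
  define M where "M = real (card X) - 1"
  have M: "real (card Y) = M" using x finite False by (simp add: Y_def M_def)
  have Mpos: "M > 0" using False by (simp add: M_def)
  \<comment> \<open>The weights \<open>x \<bullet> y\<close> have constant absolute value and flip the signs of the \<open>y\<close> so that all of them
    have positive inner product with \<open>x\<close>.\<close>
  define p where "p y = y - (x \<bullet> y) *\<^sub>R x" for y
  define q where "q = (\<Sum>y\<in>Y. (x \<bullet> y) *\<^sub>R y)"
  define u where "u = (\<Sum>y\<in>Y. (x \<bullet> y) *\<^sub>R p y)"
  have xY: "(x \<bullet> y)\<^sup>2 = \<beta>" if "y \<in> Y" for y using angle x that by (auto simp: Y_def)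
  have sq: "(\<Sum>y\<in>Y. (x \<bullet> y)\<^sup>2) = \<beta> * M" using xY M by simp
  have xq: "x \<bullet> q = \<beta> * M" using sq by (simp add: q_def inner_sum_right power2_eq_square)
  have "u = q - (\<beta> * M) *\<^sub>R x"
    by (simp add: u_def p_def q_def scaleR_diff_right sum_subtractf scaleR_sum_left power2_eq_square flip: sq)
  hence uu: "u \<bullet> u = q \<bullet> q - (\<beta> * M)\<^sup>2"
    using xq unit[OF x] by (simp add: inner_diff_left inner_diff_right inner_commute power2_eq_square)
  have "3 * (1 - \<beta>)\<^sup>2 / (DIM('a) + 2) * (u \<bullet> u) \<le> (\<Sum>y\<in>Y. \<Sum>z\<in>Y. (x \<bullet> y) * (x \<bullet> z) * (p y \<bullet> p z) ^ 3)"
    unfolding u_def 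
  proof (rule sum_inner_cubed_ge)
    fix y assume "y \<in> Y"
    hence "y \<bullet> y = 1" "(x \<bullet> y)\<^sup>2 = \<beta>" using unit xY by (auto simp: Y_def)
    thus "p y \<bullet> p y = 1 - \<beta>"
      using unit[OF x] by (simp add: p_def inner_diff_left inner_diff_right inner_commute power2_eq_square)
  qed
  also have "\<dots> = \<beta> * (1 + 3 * \<beta>) * (q \<bullet> q) - \<beta> * (3 + \<beta>) * (x \<bullet> q)\<^sup>2 
        + (1 - \<beta>) * (1 - 3 * \<beta>) * (\<Sum>y\<in>Y. (x \<bullet> y)\<^sup>2)"
    unfolding q_def p_def using x finite unit angle 
    by (intro sum_cubed_projected_gram) (auto simp: Y_def)
  also have "\<dots> = \<beta> * (1 + 3 * \<beta>) * (u \<bullet> u) + (1 - \<beta>) * \<beta> * M * ((1 - 3 * \<beta>) - M * (2 * \<beta>\<^sup>2))"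
    unfolding sq xq uu by (simp add: algebra_simps power2_eq_square)
  also have "\<beta> * (1 + 3 * \<beta>) * (u \<bullet> u) \<le> 3 * (1 - \<beta>)\<^sup>2 / (DIM('a) + 2) * (u \<bullet> u)"
    using dim by (intro mult_right_mono) (auto simp: field_simps)
  finally have "0 \<le> (1 - \<beta>) * \<beta> * M * ((1 - 3 * \<beta>) - M * (2 * \<beta>\<^sup>2))" by simp
  moreover have "0 < (1 - \<beta>) * \<beta> * M" using pos less_1 Mpos by simp
  ultimately show ?thesis by (simp add: zero_le_mult_iff M_def)
qed


text \<open>
  With \<open>Q = 1 / \<beta>\<close>, one of the three bounds applies in every dimension at least 8 but
  \<open>Q - 2\<close>, where they only give Gerzon's bound \<open>m (m + 1) / 2\<close>.
\<close>

lemma two_card_le: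
  assumes \<beta>: "\<beta> = 1 / real Q" and Q: "Q \<ge> 9" and m: "DIM('a) \<ge> 8" "DIM('a) + 2 \<noteq> Q"
  shows "2 * card X \<le> DIM('a) * (DIM('a) - 1)"
proof -
  define m N q where "m = real DIM('a)" and "N = real (card X)" and "q = real Q"
  have ge: "m \<ge> 8" "q \<ge> 9" and \<beta>q: "\<beta> = 1 / q" using m Q \<beta> by (auto simp: m_def q_def)
  hence \<beta>3: "3 * \<beta> \<le> 1" by simp
  consider "DIM('a) \<ge> Q" | "DIM('a) + 1 = Q" | "DIM('a) + 3 \<le> Q" using m by linarith
  hence "2 * N \<le> m * (m - 1)"
  proof cases
    case 1
    hence "q \<le> m" by (simp add: m_def q_def)
    have "N * (2 * \<beta>) \<le> m * (1 - \<beta>)" using projection_bound[OF \<beta>3] by (simp add: m_def N_def)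
    hence "2 * N \<le> m * (q - 1)" using ge by (simp add: \<beta>q field_simps)
    also have "\<dots> \<le> m * (m - 1)" using \<open>q \<le> m\<close> ge by (intro mult_left_mono) auto
    finally show ?thesis .
  next
    case 2
    hence mq: "m = q - 1" by (auto simp: m_def q_def)
    have "(q + 1) * (q + 3) \<le> 3 * (q - 1)\<^sup>2"
      using mult_nonneg_nonneg[of q "2 * (q - 5)"] ge
      by (simp add: power2_eq_square algebra_simps)
    hence "(m + 2) * (\<beta> * (1 + 3 * \<beta>)) \<le> 3 * (1 - \<beta>)\<^sup>2"
      using ge by (simp add: \<beta>q mq field_simps power2_eq_square)
    hence "(N - 1) * (2 * \<beta>\<^sup>2) \<le> 1 - 3 * \<beta>"
      using cubic_harmonic_bound[OF _ \<beta>3] by (simp add: m_def N_def add.commute)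
    hence "(N - 1) * (2 * \<beta>\<^sup>2) * (q * q) \<le> (1 - 3 * \<beta>) * (q * q)" by (rule mult_right_mono) simp
    moreover have "(N - 1) * (2 * \<beta>\<^sup>2) * (q * q) = 2 * (N - 1)" "(1 - 3 * \<beta>) * (q * q) = q * (q - 3)"
      using ge by (simp_all add: \<beta>q power2_eq_square field_simps)
    ultimately have "2 * (N - 1) \<le> q * (q - 3)" by simp
    thus ?thesis by (simp add: mq algebra_simps)
  next
    case 3
    hence d: "q - m \<ge> 3" by (auto simp: m_def q_def)
    have "N * (1 - m * \<beta>) \<le> m * (1 - \<beta>)" using relative_bound by (simp add: m_def N_def)
    hence "N * (1 - m * \<beta>) * q \<le> m * (1 - \<beta>) * q" using ge by (intro mult_right_mono) auto
    moreover have "N * (1 - m * \<beta>) * q = N * (q - m)" "m * (1 - \<beta>) * q = m * (q - 1)"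
      using ge by (simp_all add: \<beta>q field_simps)
    ultimately have "N * (q - m) \<le> m * (q - 1)" by simp
    hence "2 * N * (q - m) \<le> m * (2 * (q - 1))" by (simp add: algebra_simps)
    also have "5 * 1 \<le> (m - 3) * (q - m - 2)" using d ge by (intro mult_mono) auto
    hence "2 * (q - 1) \<le> (m - 1) * (q - m)" by (simp add: algebra_simps)
    hence "m * (2 * (q - 1)) \<le> m * ((m - 1) * (q - m))" using ge by (intro mult_left_mono) auto
    finally have "2 * N * (q - m) \<le> (m * (m - 1)) * (q - m)" by (simp add: mult.assoc)
    thus ?thesis using d by simp
  qed
  hence "real (2 * card X) \<le> real (DIM('a) * (DIM('a) - 1))"
    using m by (simp add: m_def N_def of_nat_diff)
  thus ?thesis by linarith
qed

end

section \<open>Eigenvalues of integer matrices of large multiplicity\<close>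

text \<open>
  The block matrix \<open>M\<close> with rows \<open>(y I, U)\<close> and \<open>(W, I)\<close> is made block triangular from the
  right in two ways, which gives \<open>det M = det (y I - U W)\<close> and
  \<open>det M * y\<^sup>r = y\<^sup>N * det (y I - W U)\<close>.
\<close>

lemma dvd_det_low_rank:
  fixes U W :: "'a :: idom mat"
  assumes U: "U \<in> carrier_mat N r" and W: "W \<in> carrier_mat r N" and y: "y \<noteq> 0" and le: "r \<le> N"
  shows "y ^ (N - r) dvd det (y \<cdot>\<^sub>m 1\<^sub>m N - U * W)"
proof -
  let ?M = "four_block_mat (y \<cdot>\<^sub>m 1\<^sub>m N) U W (1\<^sub>m r)"
  let ?L = "four_block_mat (1\<^sub>m N) (0\<^sub>m N r) (- W) (1\<^sub>m r)"
  let ?R = "four_block_mat (1\<^sub>m N) (- U) (0\<^sub>m r N) (y \<cdot>\<^sub>m 1\<^sub>m r)"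
  have M: "?M \<in> carrier_mat (N + r) (N + r)" and L: "?L \<in> carrier_mat (N + r) (N + r)"
    and R: "?R \<in> carrier_mat (N + r) (N + r)"
    using U W by auto
  have UW: "U * W \<in> carrier_mat N N" and WU: "W * U \<in> carrier_mat r r" using U W by auto
  have prod1: "?M * ?L = four_block_mat (y \<cdot>\<^sub>m 1\<^sub>m N - U * W) U (0\<^sub>m r N) (1\<^sub>m r)"
  proof -
    have "?M * ?L = four_block_mat (y \<cdot>\<^sub>m 1\<^sub>m N * 1\<^sub>m N + U * (- W)) (y \<cdot>\<^sub>m 1\<^sub>m N * 0\<^sub>m N r + U * 1\<^sub>m r)
        (W * 1\<^sub>m N + 1\<^sub>m r * (- W)) (W * 0\<^sub>m N r + 1\<^sub>m r * 1\<^sub>m r)"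
      by (rule mult_four_block_mat) (use U W in auto)
    also have "y \<cdot>\<^sub>m 1\<^sub>m N * 1\<^sub>m N + U * (- W) = y \<cdot>\<^sub>m 1\<^sub>m N - U * W"
      by (rule eq_matI) (use U W in auto)
    also have "y \<cdot>\<^sub>m 1\<^sub>m N * 0\<^sub>m N r + U * 1\<^sub>m r = U" using U by auto
    also have "W * 1\<^sub>m N + 1\<^sub>m r * (- W) = 0\<^sub>m r N" using W by auto
    also have "W * 0\<^sub>m N r + 1\<^sub>m r * 1\<^sub>m r = 1\<^sub>m r" using W by auto
    finally show ?thesis .
  qed
  have prod2: "?M * ?R = four_block_mat (y \<cdot>\<^sub>m 1\<^sub>m N) (0\<^sub>m N r) W (y \<cdot>\<^sub>m 1\<^sub>m r - W * U)"
  proof -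
    have "?M * ?R = four_block_mat (y \<cdot>\<^sub>m 1\<^sub>m N * 1\<^sub>m N + U * 0\<^sub>m r N) (y \<cdot>\<^sub>m 1\<^sub>m N * (- U) + U * (y \<cdot>\<^sub>m 1\<^sub>m r))
        (W * 1\<^sub>m N + 1\<^sub>m r * 0\<^sub>m r N) (W * (- U) + 1\<^sub>m r * (y \<cdot>\<^sub>m 1\<^sub>m r))"
      by (rule mult_four_block_mat) (use U W in auto)
    also have "y \<cdot>\<^sub>m 1\<^sub>m N * 1\<^sub>m N + U * 0\<^sub>m r N = y \<cdot>\<^sub>m 1\<^sub>m N" using U by auto
    also have "y \<cdot>\<^sub>m 1\<^sub>m N * (- U) + U * (y \<cdot>\<^sub>m 1\<^sub>m r) = 0\<^sub>m N r"
    proof -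
      have "y \<cdot>\<^sub>m 1\<^sub>m N * (- U) = y \<cdot>\<^sub>m (- U)"
        using U by (subst mult_smult_assoc_mat[of _ N N _ r]) auto
      moreover have "U * (y \<cdot>\<^sub>m 1\<^sub>m r) = y \<cdot>\<^sub>m U"
        using U by (subst mult_smult_distrib[of _ N r _ r]) auto
      ultimately show ?thesis using U by (intro eq_matI) auto
    qed
    also have "W * 1\<^sub>m N + 1\<^sub>m r * 0\<^sub>m r N = W" using W by auto
    also have "W * (- U) + 1\<^sub>m r * (y \<cdot>\<^sub>m 1\<^sub>m r) = y \<cdot>\<^sub>m 1\<^sub>m r - W * U"
      by (rule eq_matI) (use U W in auto)
    finally show ?thesis .
  qed
  have "det ?L = 1"
    using W by (subst det_four_block_mat_upper_right_zero[of _ N _ r]) auto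
  hence 1: "det ?M = det (y \<cdot>\<^sub>m 1\<^sub>m N - U * W)"
    using det_mult[OF M L] det_four_block_mat_lower_left_zero[of "y \<cdot>\<^sub>m 1\<^sub>m N - U * W" N U r "0\<^sub>m r N" "1\<^sub>m r"]
      U UW by (simp add: prod1 minus_carrier_mat)
  have "det ?R = y ^ r"
    using U by (subst det_four_block_mat_lower_left_zero[of _ N _ r]) (auto simp: det_smult)
  hence "det ?M * y ^ r = y ^ N * det (y \<cdot>\<^sub>m 1\<^sub>m r - W * U)"
    using det_mult[OF M R] det_four_block_mat_upper_right_zero[of "y \<cdot>\<^sub>m 1\<^sub>m N" N "0\<^sub>m N r" r W "y \<cdot>\<^sub>m 1\<^sub>m r - W * U"]
      W WU by (simp add: prod2 minus_carrier_mat det_smult)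
  also have "y ^ N = y ^ (N - r) * y ^ r" using le by (simp flip: power_add)
  finally have "det ?M * y ^ r = (y ^ (N - r) * det (y \<cdot>\<^sub>m 1\<^sub>m r - W * U)) * y ^ r" by (simp only: ac_simps)
  hence "det ?M = y ^ (N - r) * det (y \<cdot>\<^sub>m 1\<^sub>m r - W * U)" using y by simp
  thus ?thesis using 1 by simp
qed

text \<open>
  An irreducible rational polynomial has only simple roots, and its degree is at least 2 if it has
  an irrational root.
\<close>

lemma order_irrational_root_le:
  fixes p :: "rat poly" and x :: real
  assumes "p \<noteq> 0" and x: "x \<notin> \<rat>"
  shows "2 * order x (map_poly of_rat p) \<le> degree p"
  using assms(1)
proof (induction p rule: prime_divisors_induct)
  case zero
  thus ?case by simp
next
  case (unit p)
  have "order x (map_poly of_rat p) \<le> degree (map_poly of_rat p :: real poly)"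
    using unit.prems by (intro order_degree) simp
  thus ?case using unit by (simp add: poly_dvd_1)
next
  case (factor q p)
  interpret R: map_poly_idom_hom "of_rat :: rat \<Rightarrow> real" ..
  let ?r = "map_poly of_rat :: rat poly \<Rightarrow> real poly"
  have p0: "p \<noteq> 0" and q0: "q \<noteq> 0" using factor.prems by auto
  have pos: "degree q > 0"
    using factor.hyps q0 by (metis is_unit_iff_degree not_prime_unit bot_nat_0.not_eq_extremum)
  have "2 * order x (?r q) \<le> degree q"
  proof (cases "poly (?r q) x = 0")
    case False
    thus ?thesis by (simp add: order_root)
  next
    case True
    have "degree q \<noteq> 1"
    proof
      assume "degree q = 1"
      then obtain c d where q: "q = [:c, d:]" "d \<noteq> 0"
        by (metis degree1_coeffs One_nat_def)
      have "of_rat c + x * of_rat d = 0" using True q by simp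
      hence "x = of_rat (- c / d)" using q(2)
        by (simp add: of_rat_divide of_rat_minus field_simps)
      thus False using x by auto
    qed
    have "\<not> q dvd pderiv q"
      using pos dvd_imp_degree_le[of q "pderiv q"] by (auto simp: pderiv_eq_0_iff degree_pderiv)
    hence "coprime q (pderiv q)" using factor.hyps
      by (simp add: prime_elem_imp_coprime prime_imp_prime_elem)
    hence "fst (bezout_coefficients q (pderiv q)) * q + snd (bezout_coefficients q (pderiv q)) * pderiv q = 1"
      by (simp add: bezout_coefficients_fst_snd)
    then obtain s t where st: "s * q + t * pderiv q = 1" by blast
    have "?r s * ?r q + ?r t * pderiv (?r q) = 1"
      using arg_cong[OF st, of ?r] by (simp add: R.hom_add R.hom_mult of_rat_hom.map_poly_pderiv)
    from arg_cong[OF this, of "\<lambda>p. poly p x"] True have "poly (pderiv (?r q)) x \<noteq> 0" by auto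
    hence "order x (?r q) \<le> 1"
      using True q0 order_pderiv[of "?r q" x] order_0I[of "pderiv (?r q)" x] by simp
    thus ?thesis using \<open>degree q \<noteq> 1\<close> pos by auto
  qed
  moreover have "order x (?r (q * p)) = order x (?r q) + order x (?r p)"
    using p0 q0 by (simp add: R.hom_mult order_mult)
  ultimately show ?case using factor.IH p0 q0 by (simp add: degree_mult_eq)
qed

text \<open>
  The integer matrix \<open>g\<close> on \<open>X\<close> differs from \<open>\<theta> I\<close> by a matrix of rank at most \<open>card I\<close>. Hence \<open>\<theta>\<close>
  is a root of the characteristic polynomial of order more than \<open>card X / 2\<close>, which makes it
  rational, and it is an algebraic integer.
\<close>

lemma integral_eigenvalue_of_large_multiplicity:
  fixes g :: "'x \<Rightarrow> 'x \<Rightarrow> int" and \<theta> :: real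
  assumes X: "finite X" and I: "finite I" and card: "2 * card I < card X"
    and gram: "\<And>x y. x \<in> X \<Longrightarrow> y \<in> X \<Longrightarrow>
      of_int (g x y) - (if x = y then \<theta> else 0) = (\<Sum>i\<in>I. u x i * w y i)"
  shows "\<theta> \<in> \<int>"
proof -
  define N r where "N = card X" and "r = card I"
  obtain h where h: "bij_betw h {0..<N} X" using X ex_bij_betw_nat_finite N_def by blast
  obtain k where k: "bij_betw k {0..<r} I" using I ex_bij_betw_nat_finite r_def by blast
  define A where "A = mat N N (\<lambda>(i, j). g (h i) (h j))"
  define U where "U = mat N r (\<lambda>(i, j). u (h i) (k j))"
  define W where "W = mat r N (\<lambda>(i, j). w (h j) (k i))"
  define B where "B = (map_mat of_int A :: real mat)"
  have car: "A \<in> carrier_mat N N" "U \<in> carrier_mat N r" "W \<in> carrier_mat r N" "B \<in> carrier_mat N N"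
    by (auto simp: A_def U_def W_def B_def)
  have UW: "B $$ (i, j) - (if i = j then \<theta> else 0) = (U * W) $$ (i, j)" if "i < N" "j < N" for i j
  proof -
    have "h i \<in> X" "h j \<in> X" using h that by (auto simp: bij_betw_def)
    moreover have "h i = h j \<longleftrightarrow> i = j" using h that by (auto simp: bij_betw_def inj_on_def)
    ultimately have "B $$ (i, j) - (if i = j then \<theta> else 0) = (\<Sum>l\<in>I. u (h i) l * w (h j) l)"
      using gram[of "h i" "h j"] that by (simp add: B_def A_def)
    also have "\<dots> = (\<Sum>l\<in>{0..<r}. u (h i) (k l) * w (h j) (k l))"
      by (rule sum.reindex_bij_betw[OF k, symmetric])
    also have "\<dots> = (U * W) $$ (i, j)"
      using that by (simp add: U_def W_def scalar_prod_def)
    finally show ?thesis .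
  qed
  let ?c = "\<lambda>z::real. [:z:]"
  have eq: "char_poly_matrix B = [:-\<theta>, 1:] \<cdot>\<^sub>m 1\<^sub>m N - map_mat ?c U * map_mat ?c W"
  proof (rule eq_matI)
    fix i j assume "i < dim_row ([:-\<theta>, 1:] \<cdot>\<^sub>m 1\<^sub>m N - map_mat ?c U * map_mat ?c W)"
      "j < dim_col ([:-\<theta>, 1:] \<cdot>\<^sub>m 1\<^sub>m N - map_mat ?c U * map_mat ?c W)"
    hence ij: "i < N" "j < N" using car by auto
    have "(map_mat ?c U * map_mat ?c W) $$ (i, j) = ?c ((U * W) $$ (i, j))"
      using ij by (simp add: U_def W_def scalar_prod_def sum_to_poly mult.commute)
    thus "char_poly_matrix B $$ (i, j) = ([:-\<theta>, 1:] \<cdot>\<^sub>m 1\<^sub>m N - map_mat ?c U * map_mat ?c W) $$ (i, j)"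
      using ij car UW[OF ij, symmetric] by (simp add: char_poly_matrix_def)
  qed (use car in \<open>auto simp: char_poly_matrix_def\<close>)
  have "[:-\<theta>, 1:] ^ (N - r) dvd det (char_poly_matrix B)"
    unfolding eq using card by (intro dvd_det_low_rank) (auto simp: U_def W_def N_def r_def)
  hence dvd: "[:-\<theta>, 1:] ^ (N - r) dvd char_poly B" by (simp add: char_poly_def)
  have deg: "degree (char_poly B) = N" "char_poly B \<noteq> 0"
    using degree_monic_char_poly[OF car(4)] by auto
  have mon: "degree (char_poly A) = N" "lead_coeff (char_poly A) = 1"
    using degree_monic_char_poly[OF car(1)] by auto
  hence "char_poly A \<noteq> 0" by auto
  have hom: "char_poly B = map_poly of_int (char_poly A)"
    unfolding B_def by (rule of_int_hom.char_poly_hom[OF car(1)])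
  have ord: "N - r \<le> order \<theta> (char_poly B)"
    using order_max[OF dvd] deg by simp
  have "map_poly of_rat (map_poly of_int (char_poly A) :: rat poly) = char_poly B"
    unfolding hom by (simp add: map_poly_map_poly o_def)
  hence "\<theta> \<in> \<rat>"
    using order_irrational_root_le[of "map_poly of_int (char_poly A)" \<theta>] ord card mon \<open>char_poly A \<noteq> 0\<close>
    by (cases "\<theta> \<in> \<rat>") (auto simp: N_def r_def)
  moreover have "poly (char_poly B) \<theta> = 0"
    using ord card deg by (simp add: order_root N_def r_def)
  hence "algebraic_int \<theta>"
    unfolding algebraic_int_altdef_ipoly using mon hom by auto
  ultimately show ?thesis by (rule rational_algebraic_int_is_int[rotated])
qed

section \<open>Two inner products with negative sum\<close>

text \<open>
  Neumann's theorem, applied to the graph \<open>g\<close> of the pairs with inner product \<open>\<alpha>\<close>. If \<open>G\<close> is the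
  Gram matrix and \<open>J\<close> the all-ones matrix, then \<open>2 \<alpha> g = G + \<alpha> J - (1 + \<alpha>) I\<close>, and \<open>G + \<alpha> J\<close> has rank
  at most \<open>DIM('a) + 1\<close>; the index \<^const>\<open>None\<close> stands for the summand \<open>\<alpha> J\<close>.
\<close>

lemma (in equiangular_set) inverse_angle_odd_int:
  assumes \<alpha>: "0 < \<alpha>" "\<alpha>\<^sup>2 = \<beta>" and card: "2 * (DIM('a) + 1) < card X"
  obtains k :: int where "1 / \<alpha> = 2 * of_int k + 1"
proof -
  define \<theta> where "\<theta> = - (1 + \<alpha>) / (2 * \<alpha>)"
  define I :: "'a option set" where "I = insert None (Some ` Basis)"
  define g :: "'a \<Rightarrow> 'a \<Rightarrow> int" where "g x y = (if x \<noteq> y \<and> x \<bullet> y = \<alpha> then 1 else 0)" for x y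
  define u where "u x i = (case i of None \<Rightarrow> 1 / 2 | Some b \<Rightarrow> (x \<bullet> b) / (2 * \<alpha>))" for x :: 'a and i
  define w where "w y i = (case i of None \<Rightarrow> 1 | Some b \<Rightarrow> y \<bullet> b)" for y :: 'a and i
  have I: "finite I" "card I = DIM('a) + 1"
    by (simp_all add: I_def card_image image_iff)
  have "\<theta> \<in> \<int>"
  proof (rule integral_eigenvalue_of_large_multiplicity[OF finite I(1)])
    show "2 * card I < card X" using card I by simp
  next
    fix x y assume xy: "x \<in> X" "y \<in> X"
    have "(\<Sum>i\<in>I. u x i * w y i) = 1 / 2 + (\<Sum>b\<in>Basis. (x \<bullet> b) / (2 * \<alpha>) * (y \<bullet> b))"
      by (simp add: I_def u_def w_def image_iff sum.reindex)
    also have "(\<Sum>b\<in>Basis. (x \<bullet> b) / (2 * \<alpha>) * (y \<bullet> b)) = (x \<bullet> y) / (2 * \<alpha>)"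
      unfolding euclidean_inner[of x y] by (simp add: sum_divide_distrib)
    finally have *: "(\<Sum>i\<in>I. u x i * w y i) = (\<alpha> + x \<bullet> y) / (2 * \<alpha>)"
      using \<alpha> by (simp add: add_divide_distrib)
    show "of_int (g x y) - (if x = y then \<theta> else 0) = (\<Sum>i\<in>I. u x i * w y i)"
    proof (cases "x = y")
      case True
      thus ?thesis unfolding * using unit[OF xy(1)] by (simp add: g_def \<theta>_def add.commute minus_divide_left)
    next
      case False
      hence "(x \<bullet> y)\<^sup>2 = \<alpha>\<^sup>2" using angle xy \<alpha> by simp
      hence "x \<bullet> y = \<alpha> \<or> x \<bullet> y = - \<alpha>" by (simp add: power2_eq_iff)
      thus ?thesis unfolding * using False \<alpha> by (auto simp: g_def)
    qed
  qed
  then obtain k where k: "\<theta> = of_int k" by (rule Ints_cases)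
  have "\<theta> * (2 * \<alpha>) = - (1 + \<alpha>)" using \<alpha> by (simp add: \<theta>_def)
  hence "1 = (2 * of_int (- k - 1) + 1) * \<alpha>" unfolding k by (simp add: left_diff_distrib)
  hence "1 / \<alpha> = 2 * of_int (- k - 1) + 1" using \<alpha> by (metis nonzero_mult_div_cancel_right less_irrefl)
  thus ?thesis by (rule that)
qed

text \<open>
  The map \<open>f x = (s x, t)\<close> with \<open>s\<^sup>2 = 2 / D\<close> and \<open>t\<^sup>2 = - (a + b) / D\<close> preserves norm 1 and sends the
  inner products \<open>a\<close> and \<open>b\<close> to \<open>\<alpha>\<close> and \<open>- \<alpha>\<close>.
\<close>

lemma card_two_distance_le_of_sum_neg:
  fixes X :: "'a::euclidean_space set"
  assumes X: "finite X" and unit: "\<And>x. x \<in> X \<Longrightarrow> x \<bullet> x = 1"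
    and two: "\<And>x y. x \<in> X \<Longrightarrow> y \<in> X \<Longrightarrow> x \<noteq> y \<Longrightarrow> x \<bullet> y \<in> {a, b}"
    and ab: "b < a" "a < 1" "a + b < 0"
    and dim: "DIM('a) \<ge> 7" "\<And>j. j \<ge> 1 \<Longrightarrow> DIM('a) + 3 \<noteq> (2 * j + 1)\<^sup>2"
  shows "2 * card X \<le> DIM('a) * (DIM('a) + 1)"
proof (rule ccontr)
  assume neg: "\<not> 2 * card X \<le> DIM('a) * (DIM('a) + 1)"
  define D where "D = 2 - a - b"
  define \<alpha> where "\<alpha> = (a - b) / D"
  define s t where "s = sqrt (2 / D)" and "t = sqrt (- (a + b) / D)"
  define f :: "'a \<Rightarrow> 'a \<times> real" where "f x = (s *\<^sub>R x, t)" for x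
  have D: "D > 0" using ab by (simp add: D_def)
  have \<alpha>: "0 < \<alpha>" "\<alpha> < 1" using ab D by (simp_all add: \<alpha>_def D_def field_simps)
  have ff: "f x \<bullet> f y = (2 * (x \<bullet> y) - (a + b)) / D" for x y
  proof -
    have "f x \<bullet> f y = s\<^sup>2 * (x \<bullet> y) + t\<^sup>2" by (simp add: f_def power2_eq_square)
    also have "\<dots> = 2 / D * (x \<bullet> y) + - (a + b) / D"
      unfolding s_def t_def using D ab by (subst (1 2) real_sqrt_pow2) simp_all
    finally show ?thesis by (simp add: add_divide_distrib diff_divide_distrib)
  qed
  have inj: "inj_on f X" using D by (auto simp: inj_on_def f_def s_def)
  interpret equiangular_set "f ` X" "\<alpha>\<^sup>2"
  proof
    fix x assume "x \<in> f ` X"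
    thus "x \<bullet> x = 1" using unit D by (auto simp: ff D_def)
  next
    fix x y assume "x \<in> f ` X" "y \<in> f ` X" "x \<noteq> y"
    then obtain x' y' where xy: "x = f x'" "y = f y'" "x' \<in> X" "y' \<in> X" "x' \<noteq> y'" by blast
    hence "x' \<bullet> y' = a \<or> x' \<bullet> y' = b" using two by blast
    hence "x \<bullet> y = \<alpha> \<or> x \<bullet> y = - \<alpha>" unfolding xy ff \<alpha>_def 
      by (auto simp: minus_divide_left)
    thus "(x \<bullet> y)\<^sup>2 = \<alpha>\<^sup>2" by auto
  qed (use X \<alpha> in \<open>auto simp: power_less_one_iff\<close>)
  have "7 * (DIM('a) + 1) \<le> DIM('a) * (DIM('a) + 1)" using dim by (intro mult_right_mono) auto
  hence "2 * (DIM('a \<times> real) + 1) < card (f ` X)"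
    using neg dim unfolding card_image[OF inj] by simp
  then obtain k :: int where k: "1 / \<alpha> = 2 * of_int k + 1"
    by (rule inverse_angle_odd_int[OF \<alpha>(1) refl]) (rule that)
  have "1 / \<alpha> > 1" using \<alpha> by simp
  hence "k \<ge> 1" using k by linarith
  define j where "j = nat k"
  have j: "j \<ge> 1" "1 / \<alpha> = 2 * real j + 1" using \<open>k \<ge> 1\<close> k by (simp_all add: j_def)
  have "\<alpha>\<^sup>2 = 1 / (1 / \<alpha>)\<^sup>2" by (simp add: power_divide)
  also have "\<dots> = 1 / real ((2 * j + 1)\<^sup>2)" unfolding j(2) by simp
  finally have \<alpha>2: "\<alpha>\<^sup>2 = 1 / real ((2 * j + 1)\<^sup>2)" .
  have "3\<^sup>2 \<le> (2 * j + 1)\<^sup>2" using j(1) by (intro power_mono) auto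
  hence "2 * card (f ` X) \<le> DIM('a \<times> real) * (DIM('a \<times> real) - 1)"
    using dim(1) dim(2)[OF j(1)] by (intro two_card_le[OF \<alpha>2]) auto
  thus False using neg by (simp add: card_image[OF inj] mult.commute)
qed

text \<open>
  The numbers in the definition need not occur as inner products. One that is at least 1 does not
  occur between distinct unit vectors and is replaced here.
\<close>

lemma spherical_two_distance_setE:
  assumes "spherical_two_distance_set S"
  obtains a b where "b < a" "a < 1" "\<And>x y. x \<in> S \<Longrightarrow> y \<in> S \<Longrightarrow> x \<noteq> y \<Longrightarrow> x \<bullet> y \<in> {a, b}"
proof -
  have unit: "x \<bullet> x = 1" if "x \<in> S" for x
    using assms that by (auto simp: spherical_two_distance_set_def norm_eq_1)
  have lt: "x \<bullet> y < 1" if "x \<in> S" "y \<in> S" "x \<noteq> y" for x y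
  proof -
    have "0 < (x - y) \<bullet> (x - y)" using that by simp
    thus ?thesis using unit that by (simp add: inner_diff_left inner_diff_right inner_commute)
  qed
  obtain a b where "a \<noteq> b" and ab: "\<And>x y. x \<in> S \<Longrightarrow> y \<in> S \<Longrightarrow> x \<noteq> y \<Longrightarrow> x \<bullet> y \<in> {a, b}"
    using assms unfolding spherical_two_distance_set_def by blast
  consider "a < 1" "b < 1" | "a < 1" "b \<ge> 1" | "a \<ge> 1" "b < 1" | "a \<ge> 1" "b \<ge> 1" by linarith
  thus ?thesis
  proof cases
    case 1
    have "x \<bullet> y \<in> {max a b, min a b}" if "x \<in> S" "y \<in> S" "x \<noteq> y" for x y
      using ab[OF that] by (auto simp: min_def max_def)
    moreover have "min a b < max a b" "max a b < 1" using 1 \<open>a \<noteq> b\<close> by (auto simp: min_def max_def)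
    ultimately show ?thesis by (intro that[where a = "max a b" and b = "min a b"])
  next
    case 2
    have "x \<bullet> y \<in> {a, a - 1}" if "x \<in> S" "y \<in> S" "x \<noteq> y" for x y
      using ab[OF that] lt[OF that] 2 by auto
    with 2 show ?thesis by (intro that[where a = "a" and b = "a - 1"]) auto
  next
    case 3
    have "x \<bullet> y \<in> {b, b - 1}" if "x \<in> S" "y \<in> S" "x \<noteq> y" for x y
      using ab[OF that] lt[OF that] 3 by auto
    with 3 show ?thesis by (intro that[where a = "b" and b = "b - 1"]) auto
  next
    case 4
    have "x \<bullet> y \<in> {0, - 1}" if "x \<in> S" "y \<in> S" "x \<noteq> y" for x y
      using ab[OF that] lt[OF that] 4 by auto
    with 4 show ?thesis by (intro that[where a = "0" and b = "- 1"]) auto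
  qed
qed

section \<open>The maximum size\<close>

theorem theorem1p2:
  fixes n :: nat
  assumes "CARD('n::finite) = n"
    and "7 \<le> n" and "n \<le> 417"
    and "n \<notin> {22, 46, 78, 118, 166, 222, 286, 358}"
  shows "is_maximum_size (spherical_two_distance_set :: (real ^ 'n) set \<Rightarrow> bool) (n * (n + 1) div 2)"
proof -
  have not_square: "n + 3 \<noteq> (2 * j + 1)\<^sup>2" if "j \<ge> 1" for j
  proof
    assume eq: "n + 3 = (2 * j + 1)\<^sup>2"
    \<comment> \<open>\<open>21\<^sup>2 - 3 = 438\<close> exceeds 417.\<close>
    have "j \<le> 9"
    proof (rule ccontr)
      assume "\<not> j \<le> 9"
      hence "21\<^sup>2 \<le> (2 * j + 1)\<^sup>2" by (intro power_mono) auto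
      thus False using eq assms(3) by simp
    qed
    \<comment> \<open>\<open>j = 1\<close> gives \<open>n = 6\<close>; the other values give the excluded dimensions.\<close>
    hence "j \<in> {1, 2, 3, 4, 5, 6, 7, 8, 9}" using that by auto
    thus False using eq assms(2,4) by (auto simp: power2_eq_square)
  qed
  have bound: "card G \<le> n * (n + 1) div 2"
    if S: "spherical_two_distance_set S" and G: "G \<subseteq> S" "finite G" for S G :: "(real ^ 'n) set"
  proof -
    obtain a b where ab: "b < a" "a < 1"
      and two: "\<And>x y. x \<in> S \<Longrightarrow> y \<in> S \<Longrightarrow> x \<noteq> y \<Longrightarrow> x \<bullet> y \<in> {a, b}"
      by (rule spherical_two_distance_setE[OF S]) (rule that)
    have unit: "x \<bullet> x = 1" if "x \<in> G" for x
      using S G that by (auto simp: spherical_two_distance_set_def norm_eq_1)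
    have twoG: "x \<bullet> y \<in> {a, b}" if "x \<in> G" "y \<in> G" "x \<noteq> y" for x y
      using two G that by blast
    have dim: "DIM(real ^ 'n) = n" using assms(1) by simp
    have "2 * card G \<le> n * (n + 1)"
    proof (cases "a + b \<ge> 0")
      case True
      thus ?thesis using card_two_distance_le_of_sum_nonneg[OF G(2) unit twoG] ab
        unfolding dim by simp
    next
      case False
      thus ?thesis using card_two_distance_le_of_sum_neg[OF G(2) unit twoG] ab assms(2) not_square
        unfolding dim by simp
    qed
    thus ?thesis by simp
  qed
  show ?thesis unfolding is_maximum_size_def
  proof (intro conjI allI impI)
    show "\<exists>S :: (real ^ 'n) set. spherical_two_distance_set S \<and> finite S \<and> card S = n * (n + 1) div 2"
      using exists_spherical_two_distance_set[where 'n = 'n] assms(1,2) by simp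
  next
    fix S :: "(real ^ 'n) set" assume "spherical_two_distance_set S"
    from finite_if_finite_subsets_card_bdd[OF bound[OF this]]
    show "finite S" "card S \<le> n * (n + 1) div 2" by blast+
  qed
qed

end
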